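(* For all integers $r\ge 0$ and $s\ge 2$, $$\zeta^{\star}(\underbrace{1,\ldots,1}_{r+1},\underbrace{2,\ldots,2}_{s-1}) = \sum_{i=0}^{r}(-1)^{r-i}2^{i+1}\sum_{\substack{k_1+\cdots+k_{i+1}=r+1\\ k_j\in\mathbb{Z}_{\ge 1}}}\zeta^{\star}(k_1,\ldots,k_i,k_{i+1}+2s-2),$$ where the inner sum runs over all $(i+1)$-tuples $(k_1,\ldots,k_{i+1})$ of positive integers with sum $r+1$.
   Context: For integers $k_1,\ldots,k_n\ge 1$ with $k_n\ge 2$, the multiple zeta-star value is $$\zeta^{\star}(k_1,\ldots,k_n) := \sum_{0<m_1\le\cdots\le m_n}\frac{1}{m_1^{k_1}\cdots m_n^{k_n}}.$$ An underbrace with number $j$ means that the entry is repeated $j$ times. For $i=0$ the term $\zeta^{\star}(k_1,\ldots,k_i,k_{i+1}+2s-2)$ means $\zeta^{\star}(k_1+2s-2)$. *)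

theory Defs
  imports "HOL-Analysis.Infinite_Sum"
begin

text \<open>
  An index \<open>(k\<^sub>1, \<dots>, k\<^sub>n)\<close> is a list, with the summation variables \<open>0 < m\<^sub>1 \<le> \<dots> \<le> m\<^sub>n\<close>
  in the same order; the series converges if all entries are positive and the last is at least 2.
  For a divergent series \<^const>\<open>infsum\<close> would return the dummy value \<open>0\<close>.
\<close>

definition zeta_star :: "nat list \<Rightarrow> real" where
  "zeta_star ks =
     (\<Sum>\<^sub>\<infinity>ms\<in>{ms :: nat list. length ms = length ks \<and> sorted ms \<and> (\<forall>m\<in>set ms. 0 < m)}.
        1 / (\<Prod>j<length ks. real (ms ! j) ^ (ks ! j)))"

definition compositions :: "nat \<Rightarrow> nat \<Rightarrow> nat list set" where
  "compositions n l = {ks. length ks = l \<and> (\<forall>k\<in>set ks. 1 \<le> k) \<and> sum_list ks = n}"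

end

(* Write c(N,k) = N!^2 / ((N-k)! (N+k)!) and let p_r(k) be the coefficient of x^r in
   P_k(x) = prod_{m<=k} (m+x)/(m-x). The left-hand side, truncated at N, equals
     sum_{k<=N} c(N,k) (p_r(k) + p_r(k-1)) / k^(2s-1).
   With 2s-1 replaced by 2a+1 and s-1 twos by a, this follows by induction on a and N from
   c(N,k) - c(N-1,k) = c(N,k) k^2/N^2; for a = 0 it is, after summation by parts, a telescoping
   identity for prod_{m<=N} m/(m-x) = sum_{k<=N} (c(N,k) - c(N,k+1)) P_k(x).
   On the other side, splitting off the last entry of a composition shows that the signed sum
   over compositions also has p_r as its coefficients, so the right-hand side truncated at N is
   the same sum without c(N,k). Since 0 <= c(N,k) <= 1 and c(N,k) tends to 1 as N grows, all
   terms being nonnegative, the two limits agree. *)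
theory Submission imports Defs "HOL-Analysis.Analysis" "HOL-Real_Asymp.Real_Asymp"
begin

text \<open>The list is in reverse order: its head is the exponent of the largest summation variable.\<close>
fun trunc_star :: "nat list \<Rightarrow> nat \<Rightarrow> real" where
  "trunc_star [] N = 1"
| "trunc_star (k # ks) N = (\<Sum>m<N. trunc_star ks (Suc m) / real (Suc m) ^ k)"

text \<open>The coefficient of $x^r$ in $\prod_{m=1}^{k} (m+x)/(m-x)$.\<close>
fun gen_coeff :: "nat \<Rightarrow> nat \<Rightarrow> real" where
  "gen_coeff 0 k = 1"
| "gen_coeff (Suc r) 0 = 0"
| "gen_coeff (Suc r) (Suc k) =
     gen_coeff (Suc r) k + (gen_coeff r (Suc k) + gen_coeff r k) / real (Suc k)"

text \<open>The quotient $N!^2 / ((N-k)! (N+k)!)$, which vanishes for $k > N$.\<close>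
fun binom_ratio :: "nat \<Rightarrow> nat \<Rightarrow> real" where
  "binom_ratio N 0 = 1"
| "binom_ratio N (Suc k) = binom_ratio N k * (real N - real k) / (real N + real k + 1)"

section \<open>Bounds, limit and recurrence of the weights \<open>binom_ratio\<close>\<close>

lemma binom_ratio_eq_0: "N < k \<Longrightarrow> binom_ratio N k = 0"
proof (induction k)
  case (Suc k)
  then show ?case by (cases "N = k") auto
qed simp

lemma binom_ratio_nonneg: "0 \<le> binom_ratio N k"
proof (induction k)
  case (Suc k)
  then show ?case by (cases "k \<le> N") (auto simp: binom_ratio_eq_0)
qed simp

lemma binom_ratio_le_1: "binom_ratio N k \<le> 1"
proof (induction k)
  case (Suc k)
  show ?case
  proof (cases "k \<le> N")
    case True
    have "binom_ratio N k * ((real N - real k) / (real N + real k + 1)) \<le> 1 * 1"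
      using Suc True by (intro mult_mono) (auto simp: binom_ratio_nonneg)
    then show ?thesis by simp
  qed (auto simp: binom_ratio_eq_0)
qed simp

lemma binom_ratio_tendsto: "(\<lambda>N. binom_ratio N k) \<longlonglongrightarrow> 1"
proof (induction k)
  case (Suc k)
  have "(\<lambda>N. (real N - real k) / (real N + real k + 1)) \<longlonglongrightarrow> 1"
    by real_asymp
  from tendsto_mult[OF Suc this] show ?case by simp
qed simp

text \<open>For k <= N this is the quotient of the two factorial expressions,
  ((N+1)-k)((N+1)+k)/(N+1)^2, cleared of denominators.\<close>

lemma binom_ratio_Suc_left:
  "binom_ratio N k * (real N + 1)\<^sup>2 = binom_ratio (Suc N) k * ((real N + 1)\<^sup>2 - (real k)\<^sup>2)"
proof (induction k)
  case (Suc k)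
  have "binom_ratio N (Suc k) * (real N + 1)\<^sup>2
      = (binom_ratio N k * (real N + 1)\<^sup>2) * (real N - real k) / (real N + real k + 1)"
    by simp
  also have "\<dots> = binom_ratio (Suc N) k * ((real N + 1 - real k) * (real N + 1 + real k))
      * (real N - real k) / (real N + real k + 1)"
    unfolding Suc by (simp add: power2_eq_square algebra_simps)
  also have "\<dots> = binom_ratio (Suc N) k * (real N + 1 - real k) * (real N - real k)"
    by (simp add: divide_simps)
  also have "\<dots> = binom_ratio (Suc N) (Suc k) * ((real N + 1)\<^sup>2 - (real (Suc k))\<^sup>2)"
  proof -
    have "(real N + 1)\<^sup>2 - (real (Suc k))\<^sup>2 = (real N - real k) * (real (Suc N) + real k + 1)"
      by (simp add: power2_eq_square algebra_simps)
    moreover have "real (Suc N) + real k + 1 \<noteq> 0" by linarith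
    ultimately show ?thesis by (simp add: divide_simps)
  qed
  finally show ?case .
qed simp

text \<open>This drives the induction over the number of twos: the factor k^2 cancels two powers of
  1/k, and 1/(N+1)^2 is what a new entry 2 contributes at its largest index.\<close>

lemma binom_ratio_diff:
  "binom_ratio (Suc N) k - binom_ratio N k
     = binom_ratio (Suc N) k * (real k)\<^sup>2 / (real (Suc N))\<^sup>2"
proof -
  have "binom_ratio N k = binom_ratio (Suc N) k * ((real (Suc N))\<^sup>2 - (real k)\<^sup>2) / (real (Suc N))\<^sup>2"
    using binom_ratio_Suc_left[of N k] by (simp add: field_simps)
  then show ?thesis by (simp add: field_simps)
qed

section \<open>The left-hand side as a weighted sum of the coefficients
  \<open>gen_coeff\<close>\<close>

text \<open>Compares coefficients of x^(r+1) in (k+1-x) P_{k+1}(x) = (k+1+x) P_k(x).\<close>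

lemma gen_coeff_rec:
  "real (Suc k) * gen_coeff (Suc r) (Suc k) - gen_coeff r (Suc k)
     = real (Suc k) * gen_coeff (Suc r) k + gen_coeff r k"
  by (simp add: field_simps del: of_nat_Suc)

lemma gen_coeff_nonneg: "0 \<le> gen_coeff r k"
  by (induction r k rule: gen_coeff.induct) auto

text \<open>The closed form contains the weight at n+1, so the sum vanishes once n reaches M. In the
  induction step \<open>gen_coeff_rec\<close> moves the previous closed form from index n to
  n+1.\<close>

lemma sum_binom_ratio_gen_coeff_telescope:
  assumes "M > 0"
  shows "(\<Sum>k\<le>n. binom_ratio M k * (2 * real k + 1) / (real M + real k + 1)
            * (((real k)\<^sup>2 + real k - real M) * gen_coeff (Suc r) k - real M * gen_coeff r k))
    = - binom_ratio M (Suc n) * real (Suc n)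
        * (real (Suc n) * gen_coeff (Suc r) n + gen_coeff r n)"
proof (induction n)
  case 0
  then show ?case by (cases r) (auto simp: field_simps)
next
  case (Suc n)
  define a where "a = binom_ratio M (Suc n)"
  define x where "x = real (Suc n)"
  define u where "u = gen_coeff (Suc r) (Suc n)"
  define v where "v = gen_coeff r (Suc n)"
  define m where "m = real M"
  have pos: "m + x + 1 \<noteq> 0" unfolding m_def x_def by linarith
  have rec: "real (Suc n) * gen_coeff (Suc r) n + gen_coeff r n = x * u - v"
    using gen_coeff_rec[of n r] unfolding x_def u_def v_def by simp
  have "- a * x * (x * u - v) + a * (2 * x + 1) / (m + x + 1)
           * ((x\<^sup>2 + x - m) * u - m * v)
      = - (a * (m - x) / (m + x + 1)) * (x + 1) * ((x + 1) * u + v)"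
    using pos by (simp add: divide_simps) (simp add: algebra_simps power2_eq_square)
  moreover have "binom_ratio M (Suc (Suc n)) = a * (m - x) / (m + x + 1)"
    by (simp add: a_def m_def x_def)
  moreover have "real (Suc (Suc n)) = x + 1" by (simp add: x_def)
  ultimately show ?case
    unfolding sum.atMost_Suc Suc.IH rec
    by (simp only: a_def[symmetric] x_def[symmetric] u_def[symmetric] v_def[symmetric] m_def[symmetric])
qed

text \<open>Both sides are the coefficient of x^r in the product of m/(m-x) over m <= N. The proof
  checks that the right-hand side obeys the recurrence of the left-hand side in N and r.\<close>

lemma trunc_star_ones:
  "trunc_star (replicate r 1) N
     = (\<Sum>k\<le>N. (binom_ratio N k - binom_ratio N (Suc k)) * gen_coeff r k)"
proof (induction r arbitrary: N)
  case 0
  have "(\<Sum>k\<le>n. binom_ratio N k - binom_ratio N (Suc k)) = 1 - binom_ratio N (Suc n)" for n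
    using sum_telescope[of "binom_ratio N" n] by simp
  then show ?case by (simp add: binom_ratio_eq_0 del: binom_ratio.simps(2))
next
  case (Suc r)
  note IH = Suc.IH
  show ?case
  proof (induction N)
    case 0
    then show ?case by simp
  next
    case (Suc N)
    let ?d = "\<lambda>N k. binom_ratio N k - binom_ratio N (Suc k)"
    define m where "m = real (Suc N)"
    have m: "m > 0" by (simp add: m_def)
    \<comment> \<open>The k-th contribution to the defect of that recurrence is, up to 1/m^2, a
      summand of the telescoping sum.\<close>
    have summand: "(?d (Suc N) k - ?d N k) * gen_coeff (Suc r) k - ?d (Suc N) k * gen_coeff r k / m
       = binom_ratio (Suc N) k * (2 * real k + 1) / (m + real k + 1)
         * (((real k)\<^sup>2 + real k - m) * gen_coeff (Suc r) k - m * gen_coeff r k) / m\<^sup>2" for k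
    proof -
      define a where "a = binom_ratio (Suc N) k"
      define x where "x = real k"
      define u where "u = gen_coeff (Suc r) k"
      define v where "v = gen_coeff r k"
      have pos: "m + x + 1 \<noteq> 0" unfolding m_def x_def by linarith
      have a': "binom_ratio (Suc N) (Suc k) = a * (m - x) / (m + x + 1)"
        by (simp add: a_def m_def x_def)
      have "?d (Suc N) k - ?d N k = a * x\<^sup>2 / m\<^sup>2 - a * (m - x) / (m + x + 1) * (x + 1)\<^sup>2 / m\<^sup>2"
        using binom_ratio_diff[of N k] binom_ratio_diff[of N "Suc k"]
        unfolding a' by (simp add: a_def m_def x_def add.commute)
      moreover have "?d (Suc N) k = a - a * (m - x) / (m + x + 1)"
        unfolding a' by (simp add: a_def)
      moreover have "(a * x\<^sup>2 / m\<^sup>2 - a * (m - x) / (m + x + 1) * (x + 1)\<^sup>2 / m\<^sup>2) * u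
            - (a - a * (m - x) / (m + x + 1)) * v / m
          = a * (2 * x + 1) / (m + x + 1) * ((x\<^sup>2 + x - m) * u - m * v) / m\<^sup>2"
        using pos m by (simp add: divide_simps) (simp add: algebra_simps power2_eq_square)
      ultimately show ?thesis
        by (simp only: a_def[symmetric] x_def[symmetric] u_def[symmetric] v_def[symmetric])
    qed
    have distrib: "(\<Sum>k\<in>A. (f k - g k) * c k - f k * e k / m)
        = (\<Sum>k\<in>A. f k * c k) - (\<Sum>k\<in>A. g k * c k) - (\<Sum>k\<in>A. f k * e k) / m"
      for f g c e :: "nat \<Rightarrow> real" and A
      by (simp add: sum_subtractf left_diff_distrib sum_divide_distrib)
    have "(\<Sum>k\<le>Suc N. (?d (Suc N) k - ?d N k) * gen_coeff (Suc r) k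
             - ?d (Suc N) k * gen_coeff r k / m) = 0"
      unfolding summand sum_divide_distrib[symmetric]
      using sum_binom_ratio_gen_coeff_telescope[where M = "Suc N" and n = "Suc N" and r = r] binom_ratio_eq_0[of "Suc N" "Suc (Suc N)"]
      by (simp add: m_def del: binom_ratio.simps(2) gen_coeff.simps(3) sum.atMost_Suc)
    then have "(\<Sum>k\<le>Suc N. ?d (Suc N) k * gen_coeff (Suc r) k)
        = (\<Sum>k\<le>Suc N. ?d N k * gen_coeff (Suc r) k) + (\<Sum>k\<le>Suc N. ?d (Suc N) k * gen_coeff r k) / m"
      unfolding distrib by linarith
    \<comment> \<open>The added term k = N+1 is zero, as both of its weights lie beyond N.\<close>
    also have "(\<Sum>k\<le>Suc N. ?d N k * gen_coeff (Suc r) k) = (\<Sum>k\<le>N. ?d N k * gen_coeff (Suc r) k)"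
      unfolding sum.atMost_Suc by (simp add: binom_ratio_eq_0 del: binom_ratio.simps(2))
    finally show ?case
      using Suc.IH IH[of "Suc N"]
      by (simp add: m_def del: binom_ratio.simps(2) gen_coeff.simps(3) sum.atMost_Suc)
  qed
qed

text \<open>Induction on a and, inside it, on N. For a = 0, summation by parts turns the all-ones
  formula into increments of \<open>gen_coeff\<close>, which its recursion evaluates.\<close>

lemma trunc_star_twos_ones:
  "trunc_star (replicate a 2 @ replicate (Suc r) 1) N
     = (\<Sum>k<N. binom_ratio N (Suc k) * (gen_coeff r (Suc k) + gen_coeff r k) / real (Suc k) ^ (2 * a + 1))"
proof (induction a arbitrary: N)
  case 0
  \<comment> \<open>The boundary term at 0 is absent because \<open>gen_coeff (Suc r) 0 = 0\<close>;
    the one at n disappears for n = N.\<close>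
  have abel: "(\<Sum>k\<le>n. (binom_ratio N k - binom_ratio N (Suc k)) * gen_coeff (Suc r) k)
     = (\<Sum>k<n. binom_ratio N (Suc k) * (gen_coeff (Suc r) (Suc k) - gen_coeff (Suc r) k))
       - binom_ratio N (Suc n) * gen_coeff (Suc r) n" for n
    by (induction n) (auto simp: algebra_simps simp del: binom_ratio.simps(2) gen_coeff.simps(3))
  have "trunc_star (replicate (Suc r) 1) N
      = (\<Sum>k<N. binom_ratio N (Suc k) * (gen_coeff (Suc r) (Suc k) - gen_coeff (Suc r) k))"
    unfolding trunc_star_ones abel by (simp add: binom_ratio_eq_0 del: binom_ratio.simps(2))
  then show ?case by (simp del: binom_ratio.simps(2) replicate_Suc)
next
  case (Suc a)
  note IH = Suc.IH
  show ?case
  proof (induction N)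
    case 0
    then show ?case by simp
  next
    case (Suc N)
    let ?g = "\<lambda>k. gen_coeff r (Suc k) + gen_coeff r k"
    \<comment> \<open>By \<open>binom_ratio_diff\<close>, the first part belongs to the hypothesis
      for N and the second to the hypothesis for a at N+1.\<close>
    have summand: "binom_ratio (Suc N) (Suc k) * ?g k / real (Suc k) ^ (2 * Suc a + 1)
        = binom_ratio N (Suc k) * ?g k / real (Suc k) ^ (2 * Suc a + 1)
          + binom_ratio (Suc N) (Suc k) * ?g k / real (Suc k) ^ (2 * a + 1) / (real (Suc N))\<^sup>2" for k
    proof -
      define y where "y = real (Suc k)"
      have "y > 0" by (simp add: y_def)
      have A: "binom_ratio (Suc N) (Suc k) = binom_ratio N (Suc k)
          + binom_ratio (Suc N) (Suc k) * y\<^sup>2 / (real (Suc N))\<^sup>2" (is "?b = ?c + _")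
        using binom_ratio_diff[of N "Suc k"] unfolding y_def by simp
      have "?b * ?g k / y ^ (2 * Suc a + 1)
          = (?c + ?b * y\<^sup>2 / (real (Suc N))\<^sup>2) * ?g k / y ^ (2 * Suc a + 1)"
        by (rule arg_cong[OF A, of "\<lambda>z. z * ?g k / y ^ (2 * Suc a + 1)"])
      also have "\<dots> = ?c * ?g k / y ^ (2 * Suc a + 1)
          + ?b * ?g k * (y\<^sup>2 / y ^ (2 * Suc a + 1)) / (real (Suc N))\<^sup>2"
        by (simp add: add_divide_distrib distrib_right del: binom_ratio.simps of_nat_Suc power_Suc)
           (simp only: ac_simps)
      also have "y\<^sup>2 / y ^ (2 * Suc a + 1) = 1 / y ^ (2 * a + 1)"
        using \<open>y > 0\<close> by (simp add: power2_eq_square)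
      finally show ?thesis by (simp add: y_def)
    qed
    have "trunc_star (replicate (Suc a) 2 @ replicate (Suc r) 1) (Suc N)
      = (\<Sum>k<N. binom_ratio N (Suc k) * ?g k / real (Suc k) ^ (2 * Suc a + 1))
        + (\<Sum>k<Suc N. binom_ratio (Suc N) (Suc k) * ?g k / real (Suc k) ^ (2 * a + 1)) / (real (Suc N))\<^sup>2"
      using Suc.IH IH[of "Suc N"] by simp
    also have "(\<Sum>k<N. binom_ratio N (Suc k) * ?g k / real (Suc k) ^ (2 * Suc a + 1))
        = (\<Sum>k<Suc N. binom_ratio N (Suc k) * ?g k / real (Suc k) ^ (2 * Suc a + 1))"
      unfolding sum.lessThan_Suc by (simp add: binom_ratio_eq_0 del: binom_ratio.simps)
    finally show ?case
      unfolding summand sum.distrib sum_divide_distrib .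
  qed
qed

section \<open>Compositions split by their last entry\<close>

text \<open>A last entry 1 is dropped; a larger one is decreased by 1, which keeps the number of
  parts.\<close>

lemma compositions_Suc_Suc:
  "compositions (Suc n) (Suc l) = (\<lambda>ks. ks @ [1]) ` compositions n l
     \<union> (\<lambda>ks. butlast ks @ [Suc (last ks)]) ` compositions n (Suc l)" (is "?L = ?A \<union> ?B")
proof (intro equalityI subsetI)
  fix ks assume "ks \<in> ?L"
  then obtain js k where ks: "ks = js @ [k]" "length js = l" "\<forall>k\<in>set js. 1 \<le> k" "1 \<le> k"
      "sum_list js + k = Suc n"
    unfolding compositions_def by (cases ks rule: rev_cases) auto
  show "ks \<in> ?A \<union> ?B"
  proof (cases "k = 1")
    case True
    then show ?thesis using ks by (auto simp: compositions_def)
  next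
    case False
    then have "js @ [k - 1] \<in> compositions n (Suc l)"
      using ks by (auto simp: compositions_def)
    moreover have "ks = butlast (js @ [k - 1]) @ [Suc (last (js @ [k - 1]))]"
      using ks by simp
    ultimately show ?thesis by blast
  qed
next
  fix ks assume "ks \<in> ?A \<union> ?B"
  then show "ks \<in> ?L"
  proof
    assume "ks \<in> ?B"
    then obtain js where js: "js \<in> compositions n (Suc l)" "ks = butlast js @ [Suc (last js)]" by blast
    then obtain is' i where "js = is' @ [i]"
      unfolding compositions_def by (cases js rule: rev_cases) auto
    then show ?thesis using js by (auto simp: compositions_def)
  qed (auto simp: compositions_def)
qed

lemma compositions_0_right: "compositions n 0 = (if n = 0 then {[]} else {})"
  by (auto simp: compositions_def)

lemma compositions_empty: "n < l \<Longrightarrow> compositions n l = {}"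
proof -
  have "length ks \<le> sum_list ks" if "\<forall>k\<in>set ks. 1 \<le> k" for ks :: "nat list"
    using that by (induction ks) auto
  then show "n < l \<Longrightarrow> compositions n l = {}"
    by (force simp: compositions_def)
qed

lemma finite_compositions: "finite (compositions n l)"
proof (induction n arbitrary: l)
  case 0
  then show ?case by (cases l) (auto simp: compositions_0_right compositions_empty)
next
  case (Suc n)
  then show ?case by (cases l) (auto simp: compositions_0_right compositions_Suc_Suc)
qed

lemma sum_compositions_Suc_Suc:
  fixes F :: "nat list \<Rightarrow> real"
  shows "(\<Sum>ks\<in>compositions (Suc n) (Suc l). F ks)
     = (\<Sum>ks\<in>compositions n l. F (ks @ [1]))
       + (\<Sum>ks\<in>compositions n (Suc l). F (butlast ks @ [Suc (last ks)]))"
proof -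
  let ?f = "\<lambda>ks::nat list. ks @ [1]" and ?g = "\<lambda>ks::nat list. butlast ks @ [Suc (last ks)]"
  have "inj_on ?g (compositions n (Suc l))"
  proof (rule inj_onI)
    fix x y assume "x \<in> compositions n (Suc l)" "y \<in> compositions n (Suc l)" "?g x = ?g y"
    moreover from this have "x \<noteq> []" "y \<noteq> []" by (auto simp: compositions_def)
    ultimately show "x = y" by (metis append1_eq_conv append_butlast_last_id nat.inject)
  qed
  \<comment> \<open>Lists in the second image end in an entry of at least 2, those in the first in
    1.\<close>
  moreover have "?f ` compositions n l \<inter> ?g ` compositions n (Suc l) = {}"
  proof -
    have "last ks \<ge> 1" if "ks \<in> compositions n (Suc l)" for ks
    proof -
      have "ks \<noteq> []" using that by (auto simp: compositions_def)
      then have "last ks \<in> set ks" by simp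
      then show ?thesis using that unfolding compositions_def by blast
    qed
    then show ?thesis by fastforce
  qed
  moreover have "inj_on ?f (compositions n l)" by (auto intro: inj_onI)
  ultimately show ?thesis
    unfolding compositions_Suc_Suc
    by (subst sum.union_disjoint) (auto simp: finite_compositions sum.reindex)
qed

section \<open>Signed sums over compositions and their identification with
  \<open>gen_coeff\<close>\<close>

definition signed_sum :: "nat \<Rightarrow> nat \<Rightarrow> real" where
  "signed_sum n m = (\<Sum>l\<le>n. (- 1) ^ (n - l) * 2 ^ l * (\<Sum>ks\<in>compositions n l. trunc_star (rev ks) m))"

text \<open>The part of \<open>signed_sum (n + 1)\<close> in which the largest summation variable
  equals m. Weighted by m^(2-2s) and summed over m, it gives the right-hand side of the
  theorem.\<close>

definition signed_term :: "nat \<Rightarrow> nat \<Rightarrow> real" where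
  "signed_term n m = (\<Sum>l\<le>n. (- 1) ^ (n - l) * 2 ^ (l + 1) *
     (\<Sum>ks\<in>compositions (n + 1) (l + 1). trunc_star (rev (butlast ks)) m / real m ^ last ks))"

lemma nonempty_of_compositions: "ks \<in> compositions n (Suc l) \<Longrightarrow> ks \<noteq> []"
  by (auto simp: compositions_def)

lemma trunc_star_rev:
  "ks \<noteq> [] \<Longrightarrow> trunc_star (rev ks) m
     = (\<Sum>j<m. trunc_star (rev (butlast ks)) (Suc j) / real (Suc j) ^ last ks)"
  by (cases ks rule: rev_cases) auto

lemma signed_sum_0: "signed_sum 0 m = 1"
  by (simp add: signed_sum_def compositions_0_right)

lemma signed_sum_Suc:
  "signed_sum (Suc n) m = (\<Sum>l\<le>n. (- 1) ^ (n - l) * 2 ^ (l + 1)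
      * (\<Sum>ks\<in>compositions (n + 1) (l + 1). trunc_star (rev ks) m))"
  unfolding signed_sum_def sum.atMost_Suc_shift by (simp add: compositions_0_right)

lemma signed_sum_Suc_0: "signed_sum (Suc n) 0 = 0"
  unfolding signed_sum_Suc
  by (intro sum.neutral ballI) (simp add: trunc_star_rev nonempty_of_compositions)

lemma signed_sum_Suc_Suc: "signed_sum (Suc n) (Suc m) = signed_sum (Suc n) m + signed_term n (Suc m)"
  unfolding signed_sum_Suc signed_term_def sum.distrib[symmetric] distrib_left[symmetric]
  by (intro sum.cong refl arg_cong2[where f = "(*)"])
     (auto simp: trunc_star_rev dest!: nonempty_of_compositions)

lemma signed_term_0: "signed_term 0 m = 2 / real m"
  by (simp add: signed_term_def sum_compositions_Suc_Suc compositions_0_right compositions_empty)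

text \<open>Splitting by the last entry: dropping a 1 loses one part, hence the factor 2; decreasing
  a larger entry lowers the total but not the number of parts, hence the sign. Either way a factor
  1/m comes out.\<close>

lemma signed_term_Suc:
  "signed_term (Suc n) m = (2 * signed_sum (Suc n) m - signed_term n m) / real m"
proof -
  let ?F = "\<lambda>ks. trunc_star (rev (butlast ks)) m / real m ^ last ks"
  let ?X = "\<lambda>l. \<Sum>ks\<in>compositions (Suc n) l. trunc_star (rev ks) m"
  let ?Y = "\<lambda>l. \<Sum>ks\<in>compositions (Suc n) (Suc l). ?F ks"
  have split: "(\<Sum>ks\<in>compositions (Suc n + 1) (l + 1). ?F ks) = ?X l / real m + ?Y l / real m" for l
    by (simp add: sum_compositions_Suc_Suc[where n = "Suc n"] sum_divide_distrib mult.commute)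
  have "signed_term (Suc n) m = (\<Sum>l\<le>Suc n. (- 1) ^ (Suc n - l) * 2 ^ (l + 1) * (?X l / real m))
      + (\<Sum>l\<le>Suc n. (- 1) ^ (Suc n - l) * 2 ^ (l + 1) * (?Y l / real m))"
    unfolding signed_term_def split distrib_left sum.distrib ..
  also have "(\<Sum>l\<le>Suc n. (- 1) ^ (Suc n - l) * 2 ^ (l + 1) * (?X l / real m)) = 2 * signed_sum (Suc n) m / real m"
    unfolding signed_sum_def sum_distrib_left sum_divide_distrib
    by (intro sum.cong refl) simp
  \<comment> \<open>For l = n+1 there are more parts than the total allows.\<close>
  also have "(\<Sum>l\<le>Suc n. (- 1) ^ (Suc n - l) * 2 ^ (l + 1) * (?Y l / real m))
      = (\<Sum>l\<le>n. (- 1) ^ (Suc n - l) * 2 ^ (l + 1) * (?Y l / real m))"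
    by (simp add: compositions_empty)
  also have "\<dots> = - (signed_term n m / real m)"
    unfolding signed_term_def sum_divide_distrib[of _ "{..n}"] sum_negf[symmetric]
    by (intro sum.cong refl) (simp add: Suc_diff_le)
  finally show ?thesis by (simp add: diff_divide_distrib)
qed

text \<open>Replacing the \<open>signed_term\<close> on the right of \<open>signed_term_Suc\<close>
  by an increment of \<open>signed_sum\<close> leaves the recursion of
  \<open>gen_coeff\<close>.\<close>

lemma signed_term_eq: "signed_term n (Suc m) = (signed_sum n (Suc m) + signed_sum n m) / real (Suc m)"
proof (cases n)
  case 0
  then show ?thesis by (simp add: signed_term_0 signed_sum_0)
next
  case (Suc k)
  then show ?thesis by (simp add: signed_term_Suc signed_sum_Suc_Suc)
qed

lemma signed_sum_eq_gen_coeff: "signed_sum n m = gen_coeff n m"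
  by (induction n m rule: gen_coeff.induct)
     (auto simp: signed_sum_0 signed_sum_Suc_0 signed_sum_Suc_Suc signed_term_eq)

section \<open>Growth and convergence of the truncated sums\<close>

lemma trunc_star_nonneg: "0 \<le> trunc_star ks N"
  by (induction ks arbitrary: N) (auto intro!: sum_nonneg divide_nonneg_nonneg)

text \<open>Each term satisfies 1/b <= 2(b-a) for consecutive square roots a, b, by 2ab <= a^2+b^2 =
  2b^2-1.\<close>

lemma sum_inverse_sqrt_le: "(\<Sum>m<N. 1 / sqrt (real (Suc m))) \<le> 2 * sqrt (real N)"
proof (induction N)
  case (Suc N)
  define a where "a = sqrt (real N)"
  define b where "b = sqrt (real (Suc N))"
  have ab: "0 \<le> a" "a \<le> b" "0 < b" "b\<^sup>2 = a\<^sup>2 + 1" by (auto simp: a_def b_def)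
  have "2 * (a * b) \<le> a\<^sup>2 + b\<^sup>2" using sum_squares_bound[of a b] by simp
  then have "2 * a + 1 / b \<le> 2 * b"
    using ab by (simp add: field_simps power2_eq_square)
  then show ?case using Suc by (simp add: a_def b_def)
qed simp

text \<open>A square-root bound reproduces itself: dividing by at least m and summing only doubles
  the constant for each entry.\<close>

lemma trunc_star_bound:
  assumes "\<forall>k\<in>set ks. 1 \<le> k"
  shows "\<exists>C\<ge>0. \<forall>m. trunc_star ks (Suc m) \<le> C * sqrt (real (Suc m))"
  using assms
proof (induction ks)
  case Nil
  then show ?case by (intro exI[of _ 1]) auto
next
  case (Cons k ks)
  then obtain C where C: "C \<ge> 0" "\<And>m. trunc_star ks (Suc m) \<le> C * sqrt (real (Suc m))" by auto
  have "trunc_star (k # ks) N \<le> 2 * C * sqrt (real N)" for N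
  proof -
    have "trunc_star (k # ks) N \<le> (\<Sum>m<N. C * (1 / sqrt (real (Suc m))))"
      unfolding trunc_star.simps
    proof (rule sum_mono)
      fix m
      have "real (Suc m) ^ 1 \<le> real (Suc m) ^ k" using Cons.prems by (intro power_increasing) auto
      then have "trunc_star ks (Suc m) / real (Suc m) ^ k \<le> (C * sqrt (real (Suc m))) / real (Suc m)"
        using C by (intro frac_le) auto
      also have "\<dots> = C * (1 / sqrt (real (Suc m)))"
        by (simp add: field_simps del: of_nat_Suc)
      finally show "trunc_star ks (Suc m) / real (Suc m) ^ k \<le> C * (1 / sqrt (real (Suc m)))" .
    qed
    also have "\<dots> \<le> C * (2 * sqrt (real N))"
      unfolding sum_distrib_left[symmetric] using C sum_inverse_sqrt_le by (intro mult_left_mono) auto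
    finally show ?thesis by simp
  qed
  moreover have "0 \<le> 2 * C" using C(1) by simp
  ultimately show ?case by blast
qed

text \<open>The square-root bound and an outer exponent of at least 2 give a majorant of order
  m^(-3/2).\<close>

lemma convergent_trunc_star:
  assumes "\<forall>k\<in>set ks. 1 \<le> k" "2 \<le> k"
  shows "convergent (trunc_star (k # ks))"
proof -
  from trunc_star_bound[OF assms(1)] obtain C where
    C: "C \<ge> 0" "\<And>m. trunc_star ks (Suc m) \<le> C * sqrt (real (Suc m))" by auto
  have "summable (\<lambda>m. real (Suc m) powr (- 3 / 2))"
    using summable_real_powr_iff[of "- 3 / 2"] summable_Suc_iff[of "\<lambda>m. real m powr (- 3 / 2)"] by simp
  then have "summable (\<lambda>m. C * real (Suc m) powr (- 3 / 2))" by (rule summable_mult)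
  then have "summable (\<lambda>m. trunc_star ks (Suc m) / real (Suc m) ^ k)"
  proof (rule summable_comparison_test')
    fix m
    have "real (Suc m) ^ 2 \<le> real (Suc m) ^ k" using assms by (intro power_increasing) auto
    then have "trunc_star ks (Suc m) / real (Suc m) ^ k \<le> (C * sqrt (real (Suc m))) / real (Suc m) ^ 2"
      using C by (intro frac_le) auto
    also have "\<dots> = C * (real (Suc m) powr (1 / 2) / real (Suc m) powr 2)"
      by (simp add: powr_half_sqrt del: of_nat_Suc)
    also have "\<dots> = C * real (Suc m) powr (- 3 / 2)"
      unfolding powr_diff[symmetric] by simp
    finally show "norm (trunc_star ks (Suc m) / real (Suc m) ^ k) \<le> C * real (Suc m) powr (- 3 / 2)"
      by (simp add: trunc_star_nonneg)
  qed
  moreover have "trunc_star (k # ks) = (\<lambda>N. \<Sum>m<N. trunc_star ks (Suc m) / real (Suc m) ^ k)"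
    by (simp add: fun_eq_iff)
  ultimately show ?thesis
    by (simp only: summable_iff_convergent)
qed

section \<open>Truncated sums as finite parts of the series \<open>zeta_star\<close>\<close>

definition bounded_tuples :: "nat \<Rightarrow> nat \<Rightarrow> nat list set" where
  "bounded_tuples n N = {ms. length ms = n \<and> sorted ms \<and> (\<forall>m\<in>set ms. 0 < m \<and> m \<le> N)}"

lemma finite_bounded_tuples: "finite (bounded_tuples n N)"
proof (rule finite_subset)
  show "bounded_tuples n N \<subseteq> {ms. set ms \<subseteq> {..N} \<and> length ms = n}"
    by (auto simp: bounded_tuples_def)
qed (auto intro: finite_lists_length_eq)

lemma bounded_tuples_Suc:
  "bounded_tuples (Suc n) N = (\<lambda>(m, ms). ms @ [Suc m]) ` (SIGMA m:{..<N}. bounded_tuples n (Suc m))"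
  (is "?L = ?R")
proof (intro equalityI subsetI)
  fix xs assume xs: "xs \<in> ?L"
  then obtain ms m where ms: "xs = ms @ [m]"
    unfolding bounded_tuples_def by (cases xs rule: rev_cases) auto
  with xs obtain j where "m = Suc j" unfolding bounded_tuples_def by (cases m) auto
  with xs ms show "xs \<in> ?R"
    by (intro image_eqI[of _ _ "(j, ms)"]) (auto simp: bounded_tuples_def sorted_append)
next
  fix xs assume "xs \<in> ?R"
  then show "xs \<in> ?L" by (force simp: bounded_tuples_def sorted_append)
qed

text \<open>Splitting off the last, hence largest, variable is the recursion of
  \<open>trunc_star\<close>; therefore the list is reversed.\<close>

lemma sum_bounded_tuples:
  "(\<Sum>ms\<in>bounded_tuples (length ks) N. 1 / (\<Prod>j<length ks. real (ms ! j) ^ (ks ! j)))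
     = trunc_star (rev ks) N"
proof (induction ks arbitrary: N rule: rev_induct)
  case Nil
  have "bounded_tuples 0 N = {[]}" by (auto simp: bounded_tuples_def)
  then show ?case by simp
next
  case (snoc k ks)
  let ?T = "\<lambda>ks ms. 1 / (\<Prod>j<length ks. real (ms ! j) ^ (ks ! j))"
  let ?n = "length ks"
  have inj: "inj_on (\<lambda>(m, ms). ms @ [Suc m]) (SIGMA m:{..<N}. bounded_tuples ?n (Suc m))"
    by (auto intro: inj_onI)
  have "(\<Sum>ms\<in>bounded_tuples (length (ks @ [k])) N. ?T (ks @ [k]) ms)
      = (\<Sum>(m, ms)\<in>(SIGMA m:{..<N}. bounded_tuples ?n (Suc m)). ?T (ks @ [k]) (ms @ [Suc m]))"
    unfolding length_append list.size add_0 add_Suc_right add_0_right bounded_tuples_Suc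
    by (subst sum.reindex[OF inj]) (simp add: case_prod_unfold)
  also have "\<dots> = (\<Sum>m<N. \<Sum>ms\<in>bounded_tuples ?n (Suc m). ?T (ks @ [k]) (ms @ [Suc m]))"
    by (rule sum.Sigma[symmetric]) (auto simp: finite_bounded_tuples)
  also have "\<dots> = (\<Sum>m<N. \<Sum>ms\<in>bounded_tuples ?n (Suc m). ?T ks ms / real (Suc m) ^ k)"
  proof (intro sum.cong refl)
    fix m ms assume "ms \<in> bounded_tuples ?n (Suc m)"
    then have len: "length ms = ?n" by (simp add: bounded_tuples_def)
    have "(\<Prod>j<?n. real ((ms @ [Suc m]) ! j) ^ ((ks @ [k]) ! j)) = (\<Prod>j<?n. real (ms ! j) ^ (ks ! j))"
      by (intro prod.cong refl) (auto simp: nth_append len)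
    then show "?T (ks @ [k]) (ms @ [Suc m]) = ?T ks ms / real (Suc m) ^ k"
      by (simp add: nth_append len)
  qed
  finally show ?case
    unfolding sum_divide_distrib[symmetric] snoc.IH by simp
qed

text \<open>The terms are nonnegative, so bounded truncations give summability, and the sets
  \<open>bounded_tuples n N\<close> are cofinal among the finite index sets.\<close>

lemma trunc_star_tendsto_zeta_star:
  assumes "\<forall>k\<in>set ks. 1 \<le> k" "2 \<le> k"
  shows "trunc_star (k # rev ks) \<longlonglongrightarrow> zeta_star (ks @ [k])"
proof -
  define n where "n = length (ks @ [k])"
  define A where "A = {ms :: nat list. length ms = n \<and> sorted ms \<and> (\<forall>m\<in>set ms. 0 < m)}"
  define f where "f = (\<lambda>ms :: nat list. 1 / (\<Prod>j<n. real (ms ! j) ^ ((ks @ [k]) ! j)))"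
  have sum_f: "sum f (bounded_tuples n N) = trunc_star (k # rev ks) N" for N
    using sum_bounded_tuples[of "ks @ [k]" N] unfolding n_def f_def by simp
  have nonneg: "0 \<le> f ms" for ms by (simp add: f_def prod_nonneg)
  have sub: "bounded_tuples n N \<subseteq> A" for N by (auto simp: A_def bounded_tuples_def)
  have mono: "bounded_tuples n N \<subseteq> bounded_tuples n M" if "N \<le> M" for N M
    using that by (auto simp: bounded_tuples_def)
  have ex: "\<exists>N. F \<subseteq> bounded_tuples n N" if "finite F" "F \<subseteq> A" for F
  proof -
    have "finite (\<Union>ms\<in>F. set ms)" using that by auto
    then obtain N where "\<forall>m\<in>(\<Union>ms\<in>F. set ms). m \<le> N" using finite_nat_set_iff_bounded_le by blast
    then have "F \<subseteq> bounded_tuples n N" using that by (auto simp: A_def bounded_tuples_def)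
    then show ?thesis ..
  qed
  have conv: "convergent (trunc_star (k # rev ks))"
    using assms by (intro convergent_trunc_star) auto
  then obtain B where B: "\<And>N. trunc_star (k # rev ks) N \<le> B"
    using convergent_imp_Bseq[OF conv] by (metis BseqE abs_le_D1 real_norm_def)
  \<comment> \<open>This rules out the default value 0 of \<open>infsum\<close>.\<close>
  have "f summable_on A"
  proof (rule nonneg_bdd_above_summable_on)
    show "bdd_above (sum f ` {F. F \<subseteq> A \<and> finite F})"
    proof (rule bdd_aboveI2)
      fix F assume "F \<in> {F. F \<subseteq> A \<and> finite F}"
      then obtain N where "F \<subseteq> bounded_tuples n N" using ex by blast
      then have "sum f F \<le> sum f (bounded_tuples n N)"
        by (intro sum_mono2) (auto simp: finite_bounded_tuples nonneg)
      then show "sum f F \<le> B" using B[of N] sum_f[of N] by simp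
    qed
  qed (simp add: nonneg)
  then have "(sum f \<longlongrightarrow> infsum f A) (finite_subsets_at_top A)"
    using has_sum_infsum has_sum_def by blast
  moreover have "filterlim (bounded_tuples n) (finite_subsets_at_top A) sequentially"
    unfolding filterlim_finite_subsets_at_top
  proof (intro allI impI)
    fix X assume "finite X \<and> X \<subseteq> A"
    then obtain N where "X \<subseteq> bounded_tuples n N" using ex by blast
    then show "\<forall>\<^sub>F M in sequentially. finite (bounded_tuples n M) \<and> X \<subseteq> bounded_tuples n M \<and> bounded_tuples n M \<subseteq> A"
      using mono sub finite_bounded_tuples
      by (intro eventually_sequentiallyI[of N]) (meson subset_trans)
  qed
  ultimately have "(\<lambda>N. sum f (bounded_tuples n N)) \<longlonglongrightarrow> infsum f A"
    by (rule filterlim_compose)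
  then have "trunc_star (k # rev ks) \<longlonglongrightarrow> infsum f A" unfolding sum_f .
  moreover have "infsum f A = zeta_star (ks @ [k])"
    unfolding zeta_star_def A_def f_def n_def ..
  ultimately show ?thesis by simp
qed

section \<open>Passage to the limit and comparison of both sides\<close>

lemma trunc_star_twos_ones_limit:
  assumes L: "trunc_star (replicate a 2 @ replicate (Suc r) 1) \<longlonglongrightarrow> L"
    and R: "(\<lambda>N. \<Sum>k<N. (gen_coeff r (Suc k) + gen_coeff r k) / real (Suc k) ^ (2 * a + 1)) \<longlonglongrightarrow> R"
  shows "L = R"
proof (rule antisym)
  let ?g = "\<lambda>k. (gen_coeff r (Suc k) + gen_coeff r k) / real (Suc k) ^ (2 * a + 1)"
  have g: "0 \<le> ?g k" for k by (intro divide_nonneg_nonneg add_nonneg_nonneg gen_coeff_nonneg) auto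
  have eq: "trunc_star (replicate a 2 @ replicate (Suc r) 1) N = (\<Sum>k<N. binom_ratio N (Suc k) * ?g k)" for N
    unfolding trunc_star_twos_ones by simp
  have "(\<Sum>k<N. binom_ratio N (Suc k) * ?g k) \<le> (\<Sum>k<N. ?g k)" for N
    by (intro sum_mono mult_left_le_one_le g binom_ratio_nonneg binom_ratio_le_1)
  then show "L \<le> R" using L R unfolding eq by (intro LIMSEQ_le[OF L R]) (auto simp only: eq)
  \<comment> \<open>With K fixed, N tends to infinity first, so the finitely many weights tend to 1;
    nonnegativity lets the sum up to N dominate the one up to K.\<close>
  have "(\<Sum>k<K. ?g k) \<le> L" for K
  proof (rule LIMSEQ_le[OF _ L])
    have "(\<lambda>N. \<Sum>k<K. binom_ratio N (Suc k) * ?g k) \<longlonglongrightarrow> (\<Sum>k<K. 1 * ?g k)"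
      by (intro tendsto_sum tendsto_mult binom_ratio_tendsto tendsto_const)
    then show "(\<lambda>N. \<Sum>k<K. binom_ratio N (Suc k) * ?g k) \<longlonglongrightarrow> (\<Sum>k<K. ?g k)" by simp
    show "\<exists>M. \<forall>N\<ge>M. (\<Sum>k<K. binom_ratio N (Suc k) * ?g k)
        \<le> trunc_star (replicate a 2 @ replicate (Suc r) 1) N"
      unfolding eq
      by (intro exI[of _ K] allI impI sum_mono2 mult_nonneg_nonneg g binom_ratio_nonneg) auto
  qed
  then show "R \<le> L" by (intro LIMSEQ_le_const2[OF R]) auto
qed

theorem mainTheorem3:
  fixes r s :: nat
  assumes "s \<ge> 2"
  shows "zeta_star (replicate (r + 1) 1 @ replicate (s - 1) 2) =
    (\<Sum>i=0..r. (- 1) ^ (r - i) * 2 ^ (i + 1) *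
       (\<Sum>ks\<in>compositions (r + 1) (i + 1). zeta_star (ks[i := ks ! i + 2 * s - 2])))"
proof (rule trunc_star_twos_ones_limit)
  \<comment> \<open>One of the s-1 twos is set apart as the last entry, leaving a = s-2.\<close>
  obtain a where a: "s = Suc (Suc a)" using assms by (metis add_2_eq_Suc le_Suc_ex)
  have "trunc_star (2 # rev (replicate (r + 1) 1 @ replicate a 2))
      \<longlonglongrightarrow> zeta_star ((replicate (r + 1) 1 @ replicate a 2) @ [2])"
    by (rule trunc_star_tendsto_zeta_star) auto
  then show "trunc_star (replicate (s - 1) 2 @ replicate (Suc r) 1)
      \<longlonglongrightarrow> zeta_star (replicate (r + 1) 1 @ replicate (s - 1) 2)"
    by (simp add: a replicate_append_same)
  \<comment> \<open>Position i is the last one, so raising its exponent by 2s-2 divides each outer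
    summand by that power of the largest variable.\<close>
  have shift: "(\<lambda>N. \<Sum>k<N. trunc_star (rev (butlast ks)) (Suc k) / real (Suc k) ^ last ks / real (Suc k) ^ (2 * (s - 1)))
      \<longlonglongrightarrow> zeta_star (ks[i := ks ! i + 2 * s - 2])"
    if ks: "ks \<in> compositions (r + 1) (i + 1)" for i ks
  proof -
    from ks obtain js k where js: "ks = js @ [k]" unfolding compositions_def by (cases ks rule: rev_cases) auto
    with ks have j: "length js = i" "\<forall>k\<in>set js. 1 \<le> k" by (auto simp: compositions_def)
    have "trunc_star ((k + 2 * (s - 1)) # rev js) \<longlonglongrightarrow> zeta_star (js @ [k + 2 * (s - 1)])"
      using j assms by (intro trunc_star_tendsto_zeta_star) auto
    moreover have "js @ [k + 2 * (s - 1)] = ks[i := ks ! i + 2 * s - 2]"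
      using js j assms by (simp add: list_update_append nth_append)
    moreover have "trunc_star ((k + 2 * (s - 1)) # rev js) = (\<lambda>N. \<Sum>k<N.
        trunc_star (rev (butlast ks)) (Suc k) / real (Suc k) ^ last ks / real (Suc k) ^ (2 * (s - 1)))"
      using js by (simp add: fun_eq_iff power_add del: of_nat_Suc)
    ultimately show ?thesis by simp
  qed
  \<comment> \<open>At finite N the sums may be interchanged, which collects
    \<open>signed_term r\<close>; its denominator supplies the odd power in 2(s-1)+1.\<close>
  have "(\<Sum>i=0..r. (- 1) ^ (r - i) * 2 ^ (i + 1) * (\<Sum>ks\<in>compositions (r + 1) (i + 1).
          \<Sum>k<N. trunc_star (rev (butlast ks)) (Suc k) / real (Suc k) ^ last ks / real (Suc k) ^ (2 * (s - 1))))
      = (\<Sum>k<N. (gen_coeff r (Suc k) + gen_coeff r k) / real (Suc k) ^ (2 * (s - 1) + 1))" for N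
  proof -
    have "(gen_coeff r (Suc k) + gen_coeff r k) / real (Suc k) ^ (2 * (s - 1) + 1)
        = signed_term r (Suc k) / real (Suc k) ^ (2 * (s - 1))" for k
      by (simp add: signed_term_eq signed_sum_eq_gen_coeff)
    then show ?thesis
      unfolding signed_term_def atLeast0AtMost
      by (simp add: sum_divide_distrib sum_distrib_left sum.swap[of _ "{..<N}"] del: of_nat_Suc)
  qed
  moreover have "(\<lambda>N. \<Sum>i=0..r. (- 1) ^ (r - i) * 2 ^ (i + 1) * (\<Sum>ks\<in>compositions (r + 1) (i + 1).
          \<Sum>k<N. trunc_star (rev (butlast ks)) (Suc k) / real (Suc k) ^ last ks / real (Suc k) ^ (2 * (s - 1))))
      \<longlonglongrightarrow> (\<Sum>i=0..r. (- 1) ^ (r - i) * 2 ^ (i + 1) *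
       (\<Sum>ks\<in>compositions (r + 1) (i + 1). zeta_star (ks[i := ks ! i + 2 * s - 2])))"
    by (intro tendsto_sum tendsto_mult tendsto_const shift)
  ultimately show "(\<lambda>N. \<Sum>k<N. (gen_coeff r (Suc k) + gen_coeff r k) / real (Suc k) ^ (2 * (s - 1) + 1))
      \<longlonglongrightarrow> (\<Sum>i=0..r. (- 1) ^ (r - i) * 2 ^ (i + 1) *
       (\<Sum>ks\<in>compositions (r + 1) (i + 1). zeta_star (ks[i := ks ! i + 2 * s - 2])))"
    by simp
qed

end
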